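(* Let $\mathcal{U}$ be a ring-supporting subset of $\mathbf{Z}$ such that $(\mathcal{U}:\mathcal{U})=n\mathbf{Z}$ (with $n\geq 0$). Then $\mathcal{U}=\bigcup_{j\in J}(n\mathbf{Z}+j)$, where $J$ is a ring-supporting subset of $\mathbf{Z}_n=\mathbf{Z}/n\mathbf{Z}$ such that $(J:J)=J\cap(-J)=\{\bar{0}\}$. Moreover, the following assertions hold: (1) If $\mathcal{U}$ contains an infinite interval then exactly one of the following conditions holds: (a) $\mathcal{U}=\mathbf{Z}=(\mathcal{U}:\mathcal{U})$; (b) $\mathcal{U}$ is an additive submonoid of $\mathbf{N}$; (c) $\mathcal{U}$ is an additive submonoid of $-\mathbf{N}$. (2) If $\mathcal{U}$ does not contain an infinite interval, then $\mathcal{U}$ is a union $\mathcal{U}=\bigcup_{i\in I}[a_i,b_i]$ of finite intervals such that $a_i\leq b_i<a_{i+1}-1$ for all $i\in I$ (the second inequality being required when $i+1\in I$), where the index set $I$ is an interval of $\mathbf{Z}$. Moreover, the interval $[a_{i_0},b_{i_0}]$ containing $0$ is either $[0,r]$ or $[-r,0]$, for some natural number $r$ which, in case $n>1$, satisfies $2r<n$.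
   Context: All intervals are intervals of integers, $\mathbf{N}=\{0,1,2,\dots\}$, and natural numbers include $0$; an infinite interval is an infinite interval of $\mathbf{Z}$. For a subset $\mathcal{U}$ of an additive abelian group $G$, $(\mathcal{U}:\mathcal{U})=\{m\in G:m+\mathcal{U}=\mathcal{U}\}$ and $-\mathcal{U}=\{-u:u\in\mathcal{U}\}$. $\mathcal{U}$ is ring-supporting if $0\in\mathcal{U}$ and whenever $u,v,w\in\mathcal{U}$ satisfy $u+v+w\in\mathcal{U}$, one has $u+v\in\mathcal{U}\iff v+w\in\mathcal{U}$. For $j\in\mathbf{Z}_n$, $n\mathbf{Z}+j$ denotes the corresponding coset in $\mathbf{Z}$. *)

theory Defs
  imports "HOL-Algebra.IntRing"
begin

text \<open>Additive abelian groups are taken as the additive part of HOL-Algebra ring records, so that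
  the notions below apply both to \<open>\<Z>\<close> (\<open>int_ring\<close>) and to \<open>ZFact n\<close>.  The latter is \<open>\<Z>/n\<Z>\<close> for
  every integer \<open>n\<close>, including \<open>n = 0\<close>, and its elements are the cosets themselves.\<close>

definition ring_supporting :: "('a, 'b) ring_scheme \<Rightarrow> 'a set \<Rightarrow> bool" where
  "ring_supporting G U \<longleftrightarrow>
     U \<subseteq> carrier G \<and> \<zero>\<^bsub>G\<^esub> \<in> U \<and>
     (\<forall>u\<in>U. \<forall>v\<in>U. \<forall>w\<in>U. u \<oplus>\<^bsub>G\<^esub> v \<oplus>\<^bsub>G\<^esub> w \<in> U \<longrightarrow>
        (u \<oplus>\<^bsub>G\<^esub> v \<in> U \<longleftrightarrow> v \<oplus>\<^bsub>G\<^esub> w \<in> U))"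

text \<open>\<open>transl_stab G U\<close> is \<open>(U : U)\<close>.\<close>

definition transl_stab :: "('a, 'b) ring_scheme \<Rightarrow> 'a set \<Rightarrow> 'a set" where
  "transl_stab G U = {m \<in> carrier G. m <+\<^bsub>G\<^esub> U = U}"

definition int_interval :: "int set \<Rightarrow> bool" where
  "int_interval S \<longleftrightarrow> (\<forall>x\<in>S. \<forall>y\<in>S. {x..y} \<subseteq> S)"

definition contains_infinite_interval :: "int set \<Rightarrow> bool" where
  "contains_infinite_interval U \<longleftrightarrow> (\<exists>S. int_interval S \<and> infinite S \<and> S \<subseteq> U)"

definition exactly_one_of_three :: "bool \<Rightarrow> bool \<Rightarrow> bool \<Rightarrow> bool" where
  "exactly_one_of_three A B C \<longleftrightarrow>
     (A \<and> \<not> B \<and> \<not> C) \<or> (\<not> A \<and> B \<and> \<not> C) \<or> (\<not> A \<and> \<not> B \<and> C)"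

end

theory Submission
  imports Defs
begin

text \<open>If both \<open>u\<close> and \<open>-u\<close> lie in \<open>U\<close>, the triples \<open>(u, -u, v)\<close> and \<open>(-u, u, v)\<close> show that \<open>u\<close> stabilizes
  \<open>U\<close>; hence \<open>U \<inter> -U\<close> is the stabilizer.  If \<open>U\<close> contains a ray \<open>[a, \<infinity>)\<close>, the triples \<open>(u, v, w)\<close>
  with \<open>w\<close> large make \<open>U\<close> additively closed, and a negative element would have a multiple opposite
  to an element of the ray.  Otherwise \<open>U\<close> is a disjoint union of maximal finite intervals, and
  \<open>1\<close>, \<open>-1\<close> cannot both lie in \<open>U\<close>.\<close>

section \<open>Ring-supporting sets of integers with stabilizer nZ\<close>

locale int_ring_supporting =
  fixes U :: "int set" and n :: nat
  assumes zero_mem: "0 \<in> U"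
    and assoc_closed: "\<lbrakk>u \<in> U; v \<in> U; w \<in> U; u + v + w \<in> U\<rbrakk> \<Longrightarrow> u + v \<in> U \<longleftrightarrow> v + w \<in> U"
    and stab_iff: "(\<forall>x. x + m \<in> U \<longleftrightarrow> x \<in> U) \<longleftrightarrow> int n dvd m"
begin

lemma add_multiple_iff: "int n dvd m \<Longrightarrow> x + m \<in> U \<longleftrightarrow> x \<in> U"
  using stab_iff by blast

lemma cong_mem_iff:
  assumes "int n dvd x - y"
  shows "x \<in> U \<longleftrightarrow> y \<in> U"
  using add_multiple_iff[OF assms, of y] by simp

lemma uminus_mem_iff:
  assumes "u \<in> U"
  shows "- u \<in> U \<longleftrightarrow> int n dvd u"
proof
  assume m: "- u \<in> U"
  \<comment> \<open>The triple sums to \<open>v\<close> and its first pair to \<open>0\<close>, both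
    in \<open>U\<close>, so its last pair \<open>u + v\<close> lies in \<open>U\<close>.\<close>
  have plus: "v + u \<in> U" if "v \<in> U" for v
    using assoc_closed[of "- u" u v] that assms m zero_mem by (simp add: add.commute)
  have minus: "v - u \<in> U" if "v \<in> U" for v
    using assoc_closed[of u "- u" v] that assms m zero_mem by simp
  have "x + u \<in> U \<longleftrightarrow> x \<in> U" for x
    using plus[of x] minus[of "x + u"] by auto
  then show "int n dvd u"
    using stab_iff by blast
next
  assume "int n dvd u"
  then show "- u \<in> U"
    using cong_mem_iff[of "- u" 0] zero_mem by simp
qed

text \<open>The hypotheses are invariant under \<open>x \<mapsto> - x\<close>, with the same
  \<open>n\<close>. This reduces claims about left rays and left ends to those about right
  ones.\<close>

lemma uminus_image: "int_ring_supporting (uminus ` U) n"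
proof -
  have mem: "x \<in> uminus ` U \<longleftrightarrow> - x \<in> U" for x
    by (metis image_iff minus_minus)
  show ?thesis
  proof
    show "0 \<in> uminus ` U"
      using mem zero_mem by simp
  next
    fix u v w
    assume "u \<in> uminus ` U" "v \<in> uminus ` U" "w \<in> uminus ` U" "u + v + w \<in> uminus ` U"
    then show "u + v \<in> uminus ` U \<longleftrightarrow> v + w \<in> uminus ` U"
      unfolding mem using assoc_closed[of "- u" "- v" "- w"] by (simp add: algebra_simps)
  next
    fix m
    have "(\<forall>x. x + m \<in> uminus ` U \<longleftrightarrow> x \<in> uminus ` U) \<longleftrightarrow> (\<forall>x. x + - m \<in> U \<longleftrightarrow> x \<in> U)"
      unfolding mem by (metis minus_add_distrib minus_minus)
    then show "(\<forall>x. x + m \<in> uminus ` U \<longleftrightarrow> x \<in> uminus ` U) \<longleftrightarrow> int n dvd m"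
      using stab_iff[of "- m"] by simp
  qed
qed

text \<open>Here \<open>1\<close> stabilizes \<open>U\<close>, so \<open>n\<close> divides
  \<open>1\<close> and every integer is congruent to \<open>0\<close>.\<close>

lemma unit_opposite_imp_UNIV:
  assumes "1 \<in> U" "- 1 \<in> U"
  shows "n = 1" "U = UNIV"
proof -
  show n: "n = 1"
    using uminus_mem_iff[of 1] assms by simp
  show "U = UNIV"
    using cong_mem_iff[of _ 0] zero_mem n by auto
qed

lemma ray_cases:
  assumes ray: "{a..} \<subseteq> U"
  shows "(n = 1 \<and> U = UNIV) \<or> (U \<subseteq> {0..} \<and> (\<forall>u\<in>U. \<forall>v\<in>U. u + v \<in> U))"
proof (cases "n = 0")
  case False
  have "x \<in> U" for x
  proof -
    \<comment> \<open>Since \<open>n \<ge> 1\<close>, this multiple of \<open>n\<close> is large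
      enough to carry \<open>x\<close> into the ray; periodicity then brings membership back to
      \<open>x\<close>.\<close>
    have "1 * (\<bar>a\<bar> + \<bar>x\<bar>) \<le> int n * (\<bar>a\<bar> + \<bar>x\<bar>)"
      using False by (intro mult_right_mono) auto
    then have "x + int n * (\<bar>a\<bar> + \<bar>x\<bar>) \<in> U"
      using ray by auto
    then show ?thesis
      using add_multiple_iff[of "int n * (\<bar>a\<bar> + \<bar>x\<bar>)" x] by simp
  qed
  then show ?thesis
    using unit_opposite_imp_UNIV by auto
next
  case True
  have add: "u + v \<in> U" if "u \<in> U" "v \<in> U" for u v
  proof -
    \<comment> \<open>Chosen so that \<open>w\<close>, \<open>v + w\<close> and
      \<open>u + v + w\<close> are all at least \<open>a\<close>; associativity then transfers
      membership from \<open>v + w\<close> to \<open>u + v\<close>.\<close>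
    define w where "w = \<bar>a\<bar> + \<bar>u\<bar> + \<bar>v\<bar>"
    have "w \<in> U" "v + w \<in> U" "u + v + w \<in> U"
      using ray by (auto simp: w_def)
    then show ?thesis
      using assoc_closed[of u v w] that by simp
  qed
  have "0 \<le> u" if u: "u \<in> U" for u
  proof (rule ccontr)
    assume neg: "\<not> 0 \<le> u"
    have mult: "int m * u \<in> U" for m
      by (induction m) (use zero_mem add u in \<open>auto simp: algebra_simps\<close>)
    \<comment> \<open>As \<open>- u \<ge> 1\<close>, this positive \<open>m\<close> makes
      \<open>- (m * u)\<close> at least \<open>a\<close>. Then \<open>m * u\<close> and its opposite
      both lie in \<open>U\<close>, and \<open>n = 0\<close> forces
      \<open>m * u = 0\<close>.\<close>
    define m where "m = nat (\<bar>a\<bar> + 1)"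
    have "int m * 1 \<le> int m * (- u)"
      using neg by (intro mult_left_mono) auto
    then have "- (int m * u) \<in> U"
      using ray by (auto simp: m_def)
    then have "int m * u = 0"
      using uminus_mem_iff[OF mult] True by auto
    then show False
      using neg by (auto simp: m_def)
  qed
  then show ?thesis
    using add by auto
qed

text \<open>If \<open>n \<le> 2 * r\<close>, then \<open>n - r\<close>, which is congruent to
  \<open>- r\<close>, lies in the interval as long as \<open>r \<le> n\<close>. So \<open>r\<close>
  has its opposite in \<open>U\<close> and \<open>n\<close> divides \<open>r\<close>, whence
  \<open>n \<le> r\<close>. The interval then contains \<open>1\<close> and \<open>n - 1\<close>,
  the latter congruent to \<open>- 1\<close>, which forces \<open>n = 1\<close>.\<close>

lemma initial_interval_short:
  assumes "{0..int r} \<subseteq> U" "n > 1"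
  shows "2 * r < n"
proof (rule ccontr)
  assume long: "\<not> 2 * r < n"
  have below: "x \<in> U" if "0 \<le> x" "x \<le> int r" for x
    using assms that by auto
  have "- int r \<in> U"
  proof (cases "r \<le> n")
    case True
    then show ?thesis
      using cong_mem_iff[of "- int r" "int n - int r"] below[of "int n - int r"] long by auto
  next
    case False
    then have "1 \<in> U" "int n - 1 \<in> U"
      using below assms(2) by auto
    then have "U = UNIV"
      using unit_opposite_imp_UNIV(2) cong_mem_iff[of "- 1" "int n - 1"] by simp
    then show ?thesis
      by simp
  qed
  then have "n dvd r"
    using uminus_mem_iff below[of "int r"] by auto
  then have "n \<le> r"
    using long assms(2) by (intro dvd_imp_le) auto
  then have "1 \<in> U" "int n - 1 \<in> U"
    using below assms(2) by auto
  then have "n = 1"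
    using cong_mem_iff[of "- 1" "int n - 1"] by (intro unit_opposite_imp_UNIV(1)) simp_all
  then show False
    using assms(2) by simp
qed

text \<open>With \<open>0\<close> in the interior, the interval would contain \<open>1\<close> and
  \<open>- 1\<close>, making \<open>U\<close> everything; so \<open>0\<close> is an endpoint. When
  it is the right one, the bound on the length comes from reflection.\<close>

lemma zero_interval_shape:
  assumes sub: "{a..b} \<subseteq> U" and zero: "0 \<in> {a..b}" and ne: "U \<noteq> UNIV"
  shows "\<exists>r :: nat. ({a..b} = {0..int r} \<or> {a..b} = {- int r..0}) \<and> (n > 1 \<longrightarrow> 2 * r < n)"
proof (cases "a = 0")
  case True
  then show ?thesis
    using sub zero initial_interval_short[of "nat b"] by (intro exI[of _ "nat b"]) auto
next
  case False
  have "b = 0"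
  proof (rule ccontr)
    assume "b \<noteq> 0"
    then have "1 \<in> U" "- 1 \<in> U"
      using False sub zero by auto
    then show False
      using unit_opposite_imp_UNIV ne by blast
  qed
  moreover have "2 * nat (- a) < n" if "n > 1"
  proof -
    interpret neg: int_ring_supporting "uminus ` U" n
      by (rule uminus_image)
    have "{0..int (nat (- a))} = uminus ` {a..b}"
      using zero \<open>b = 0\<close> by auto
    then show ?thesis
      using neg.initial_interval_short[of "nat (- a)"] that sub by blast
  qed
  ultimately show ?thesis
    using zero by (intro exI[of _ "nat (- a)"]) auto
qed

end

section \<open>Infinite intervals of integers\<close>

lemma infinite_int_interval_cases:
  assumes "int_interval S" "infinite S"
  obtains a where "{a..} \<subseteq> S" | a where "{..a} \<subseteq> S"
proof -
  obtain s where s: "s \<in> S"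
    using assms(2) by fastforce
  have between: "z \<in> S" if "x \<in> S" "y \<in> S" "x \<le> z" "z \<le> y" for x y z
    using assms(1) that unfolding int_interval_def by (meson atLeastAtMost_iff subsetD)
  show ?thesis
  \<comment> \<open>An infinite set of integers is unbounded on some side; convexity fills the ray
    from \<open>s\<close> towards that side.\<close>
  proof (cases "\<forall>x. \<exists>y\<in>S. x \<le> y")
    case True
    have "x \<in> S" if "s \<le> x" for x
      using True between[OF s _ that] by blast
    then have "{s..} \<subseteq> S"
      by auto
    then show ?thesis
      using that by blast
  next
    case False
    then obtain c where c: "\<forall>y\<in>S. y < c"
      by (meson not_le)
    have "\<exists>y\<in>S. y \<le> x" for x
    proof (rule ccontr)
      assume "\<not> (\<exists>y\<in>S. y \<le> x)"
      then have "S \<subseteq> {x..c}"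
        using c by force
      then show False
        using assms(2) finite_subset by blast
    qed
    then have "x \<in> S" if "x \<le> s" for x
      using between[OF _ s _ that] by blast
    then have "{..s} \<subseteq> S"
      by auto
    then show ?thesis
      using that by blast
  qed
qed

lemma contains_infinite_interval_iff:
  "contains_infinite_interval U \<longleftrightarrow> (\<exists>a. {a..} \<subseteq> U \<or> {..a} \<subseteq> U)"
proof
  assume "contains_infinite_interval U"
  then show "\<exists>a. {a..} \<subseteq> U \<or> {..a} \<subseteq> U"
    unfolding contains_infinite_interval_def
    by (metis infinite_int_interval_cases subset_trans)
next
  have "int_interval {a..}" "int_interval {..a}" for a :: int
    by (auto simp: int_interval_def)
  moreover have "infinite {a..}" "infinite {..a}" for a :: int
    by (rule infinite_Ici, rule infinite_Iic)
  ultimately show "contains_infinite_interval U" if "\<exists>a. {a..} \<subseteq> U \<or> {..a} \<subseteq> U"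
    using that unfolding contains_infinite_interval_def by metis
qed

section \<open>Increasing enumeration of a set of integers\<close>

lemma ex_counting_function:
  fixes L :: "int set"
  obtains f :: "int \<Rightarrow> int" where "\<And>x. f x = f (x - 1) + of_bool (x \<in> L)"
proof
  let ?g = "\<lambda>x::int. (of_bool (x \<in> L) :: int)"
  \<comment> \<open>Signed count of \<open>L\<close> relative to \<open>0\<close>: elements in
    \<open>(0, x]\<close> count positively, those in \<open>(x, 0]\<close> negatively. With these
    half-open ends the step from \<open>x - 1\<close> to \<open>x\<close> depends on
    \<open>x\<close> alone, on both sides of \<open>0\<close>.\<close>
  let ?f = "\<lambda>x. sum ?g {0<..x} - sum ?g {x<..0}"
  show "?f x = ?f (x - 1) + of_bool (x \<in> L)" for x
  proof (cases "x > 0")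
    case True
    then have "{0<..x} = insert x {0<..x - 1}" "{x<..0} = {}" "{x - 1<..0} = {}"
      by auto
    then show ?thesis by simp
  next
    case False
    then have "{x - 1<..0} = insert x {x<..0}" "{0<..x} = {}" "{0<..x - 1} = {}"
      by auto
    then show ?thesis by simp
  qed
qed

text \<open>The counting function rises by one exactly at the elements of \<open>L\<close>, so it
  maps \<open>L\<close> increasingly onto an interval, and its inverse is the enumeration. Indexing
  by an interval of Z covers \<open>L\<close> finite or unbounded on either side.\<close>

lemma int_set_enumeration:
  fixes L :: "int set"
  obtains I :: "int set" and a where "int_interval I" "bij_betw a I L" "strict_mono_on I a"
proof -
  obtain f :: "int \<Rightarrow> int" where f_step: "\<And>x. f x = f (x - 1) + of_bool (x \<in> L)"
    using ex_counting_function by blast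
  have mono: "f x \<le> f y" if "x \<le> y" for x y
    using that
  proof (induction y rule: int_ge_induct)
    case (step y)
    then show ?case
      using f_step[of "y + 1"] by simp
  qed simp
  have smono: "f x < f y" if "x < y" "y \<in> L" for x y
    using mono[of x "y - 1"] f_step[of y] that by simp
  have inj: "inj_on f L"
    by (rule linorder_inj_onI') (use smono in force)
  \<comment> \<open>Discrete intermediate value property: \<open>f\<close> rises by at most one per
    step, so a value is first reached at a point of \<open>L\<close>.\<close>
  have onto: "\<exists>z\<in>L. f z = k" if "x \<in> L" "f x \<le> k" "k \<le> f y" "x \<le> y" for x y k
    using that(4,3)
  proof (induction y rule: int_ge_induct)
    case base
    then show ?case
      using that by force
  next
    case (step y)
    show ?case
    proof (cases "k \<le> f y")
      case True
      then show ?thesis using step by blast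
    next
      case False
      then have "y + 1 \<in> L" "f (y + 1) = k"
        using f_step[of "y + 1"] step.prems by (auto split: if_splits)
      then show ?thesis by blast
    qed
  qed
  let ?a = "inv_into L f"
  have f_a: "f (?a i) = i" if "i \<in> f ` L" for i
    using that by (rule f_inv_into_f)
  show ?thesis
  proof
    show "bij_betw ?a (f ` L) L"
      using inj by (intro bij_betw_inv_into inj_on_imp_bij_betw)
    show "strict_mono_on (f ` L) ?a"
      by (intro strict_mono_onI) (metis f_a mono not_le)
    show "int_interval (f ` L)"
      unfolding int_interval_def
    proof (intro ballI subsetI)
      fix i j k
      assume "i \<in> f ` L" "j \<in> f ` L" and k: "k \<in> {i..j}"
      then obtain x y where xy: "x \<in> L" "i = f x" "y \<in> L" "j = f y"
        by blast
      show "k \<in> f ` L"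
      proof (cases "x \<le> y")
        case True
        then show ?thesis
          using onto[of x k y] xy k by auto
      next
        case False
        \<comment> \<open>With \<open>y < x\<close>, monotonicity gives \<open>j \<le> i\<close>, so
          \<open>{i..j}\<close> has at most one point.\<close>
        then have "k = f x"
          using mono[of y x] xy k by auto
        then show ?thesis
          using xy by blast
      qed
    qed
  qed
qed

section \<open>Decomposition into maximal finite intervals\<close>

lemma ex_right_end:
  fixes c :: int
  assumes "c \<in> U" "\<not> {c..} \<subseteq> U"
  obtains b where "c \<le> b" "{c..b} \<subseteq> U" "b + 1 \<notin> U"
proof (rule ccontr)
  assume no: "\<not> thesis"
  have no_end: "\<not> (c \<le> b \<and> {c..b} \<subseteq> U \<and> b + 1 \<notin> U)" for b
    using no that by blast
  \<comment> \<open>Without a last point, membership propagates upwards from \<open>c\<close> and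
    fills the ray.\<close>
  have "{c..y} \<subseteq> U" if "c \<le> y" for y
    using that
  proof (induction y rule: int_ge_induct)
    case base
    then show ?case using assms by simp
  next
    case (step y)
    then have "y + 1 \<in> U"
      using no_end by blast
    moreover have "{c..y + 1} = insert (y + 1) {c..y}"
      using step by auto
    ultimately show ?case
      using step by simp
  qed
  then show False
    using assms(2) by force
qed

lemma ex_left_end:
  fixes c :: int
  assumes "c \<in> U" "\<not> {..c} \<subseteq> U"
  obtains a where "a \<le> c" "{a..c} \<subseteq> U" "a - 1 \<notin> U"
proof -
  have flip: "x \<in> uminus ` U \<longleftrightarrow> - x \<in> U" for x
    by (metis image_iff minus_minus)
  obtain b where b: "- c \<le> b" "{- c..b} \<subseteq> uminus ` U" "b + 1 \<notin> uminus ` U"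
  proof (rule ex_right_end[of "- c" "uminus ` U"])
    obtain x where "x \<le> c" "x \<notin> U"
      using assms(2) by auto
    then have "- x \<in> {- c..}" "- x \<notin> uminus ` U"
      by (auto simp: flip)
    then show "\<not> {- c..} \<subseteq> uminus ` U"
      by blast
  qed (use assms in auto)
  have "x \<in> U" if "x \<in> {- b..c}" for x
  proof -
    have "- x \<in> {- c..b}" using that by auto
    then have "- x \<in> uminus ` U" using b by blast
    then show ?thesis by (simp add: flip)
  qed
  then have "{- b..c} \<subseteq> U"
    by blast
  moreover have "- b - 1 \<notin> U"
    using b(3) unfolding flip by simp
  ultimately show ?thesis
    using that[of "- b"] b(1) by auto
qed

text \<open>The left endpoints are the elements whose predecessor is missing; they are enumerated
  increasingly, and each is prolonged to its right end. Excluding right rays makes the right ends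
  exist; excluding left rays puts every element above some left endpoint. The gap is stated for all
  \<open>i < j\<close>, which also gives disjointness.\<close>

lemma int_set_maximal_intervals:
  fixes U :: "int set"
  assumes "\<nexists>c. {c..} \<subseteq> U" "\<nexists>c. {..c} \<subseteq> U"
  obtains I :: "int set" and a b where "int_interval I" "U = (\<Union>i\<in>I. {a i..b i})"
    "\<forall>i\<in>I. a i \<le> b i" "\<forall>i\<in>I. \<forall>j\<in>I. i < j \<longrightarrow> b i < a j - 1"
proof -
  define L where "L = {x \<in> U. x - 1 \<notin> U}"
  obtain I :: "int set" and a where I: "int_interval I" and bij: "bij_betw a I L"
    and smono: "strict_mono_on I a"
    using int_set_enumeration by blast
  have a_L: "a i \<in> U" "a i - 1 \<notin> U" if "i \<in> I" for i
    using bij_betw_apply[OF bij that] by (auto simp: L_def)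
  have "\<exists>b. a i \<le> b \<and> {a i..b} \<subseteq> U \<and> b + 1 \<notin> U" if "i \<in> I" for i
    by (rule ex_right_end[OF a_L(1)[OF that]]) (use assms(1) in blast)+
  then obtain b where b: "\<And>i. i \<in> I \<Longrightarrow> a i \<le> b i \<and> {a i..b i} \<subseteq> U \<and> b i + 1 \<notin> U"
    by metis
  show ?thesis
  proof
    show "int_interval I" by (rule I)
    show "\<forall>i\<in>I. a i \<le> b i"
      using b by blast
    show "\<forall>i\<in>I. \<forall>j\<in>I. i < j \<longrightarrow> b i < a j - 1"
    proof (intro ballI impI, rule ccontr)
      fix i j
      assume ij: "i \<in> I" "j \<in> I" "i < j"
      assume "\<not> b i < a j - 1"
      moreover have "a i < a j"
        using smono ij by (simp add: strict_mono_on_def)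
      \<comment> \<open>The predecessor of the left endpoint \<open>a j\<close> would then belong to
        \<open>U\<close>.\<close>
      ultimately have "a j - 1 \<in> {a i..b i}"
        by auto
      then show False
        using b a_L ij by blast
    qed
    show "U = (\<Union>i\<in>I. {a i..b i})"
    proof
      show "U \<subseteq> (\<Union>i\<in>I. {a i..b i})"
      proof
        fix x
        assume "x \<in> U"
        then obtain l where l: "l \<le> x" "{l..x} \<subseteq> U" "l - 1 \<notin> U"
          using ex_left_end assms(2) by metis
        then have "l \<in> L"
          by (auto simp: L_def)
        then obtain i where i: "i \<in> I" "a i = l"
          using bij by (metis bij_betw_iff_bijections)
        have "x \<le> b i"
        proof (rule ccontr)
          assume "\<not> x \<le> b i"
          \<comment> \<open>The missing point \<open>b i + 1\<close> would lie in the run from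
            \<open>l\<close> to \<open>x\<close>, which is contained in \<open>U\<close>.\<close>
          then have "b i + 1 \<in> {l..x}"
            using b[of i] i by auto
          then show False
            using b i l by blast
        qed
        then show "x \<in> (\<Union>i\<in>I. {a i..b i})"
          using i l by auto
      qed
    qed (use b in blast)
  qed
qed

section \<open>Residue classes as cosets, and arithmetic of Z/kZ\<close>

lemma ZMod_eq_iff_dvd: "ZMod k x = ZMod k y \<longleftrightarrow> k dvd x - y"
  by (simp add: ZMod_eq_mod mod_eq_dvd_iff)

text \<open>Elements of \<open>ZFact k\<close> are sets of integers, so a union of classes is again
  a set of integers. Conversely to the divisibility, \<open>y\<close> lies in its own coset, which
  equals that of \<open>x\<close>.\<close>

lemma mem_ZMod_iff: "y \<in> ZMod k x \<longleftrightarrow> k dvd y - x"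
proof
  show "k dvd y - x" if "y \<in> ZMod k x"
    using rcos_zfact[OF that] by auto
next
  interpret ideal "Idl\<^bsub>\<Z>\<^esub> {k}" \<Z>
    by (rule int.genideal_ideal) simp
  assume "k dvd y - x"
  then have "ZMod k x = ZMod k y"
    by (metis ZMod_eq_iff_dvd)
  then show "y \<in> ZMod k x"
    using a_rcos_self[of y] by (simp add: ZMod_def)
qed

lemma ZMod_ring_hom: "ring_hom_ring \<Z> (ZFact k) (ZMod k)"
proof -
  interpret ideal "Idl\<^bsub>\<Z>\<^esub> {k}" \<Z>
    by (rule int.genideal_ideal) simp
  show ?thesis
    using rcos_ring_hom_ring unfolding ZFact_def ZMod_def[abs_def] .
qed

lemma
  shows ZMod_add: "ZMod k x \<oplus>\<^bsub>ZFact k\<^esub> ZMod k y = ZMod k (x + y)"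
    and ZMod_zero: "\<zero>\<^bsub>ZFact k\<^esub> = ZMod k 0"
    and ZMod_uminus: "\<ominus>\<^bsub>ZFact k\<^esub> ZMod k x = ZMod k (- x)"
proof -
  interpret ring_hom_ring \<Z> "ZFact k" "ZMod k"
    by (rule ZMod_ring_hom)
  show "ZMod k x \<oplus>\<^bsub>ZFact k\<^esub> ZMod k y = ZMod k (x + y)"
    using hom_add[of x y] by simp
  show "\<zero>\<^bsub>ZFact k\<^esub> = ZMod k 0"
    using hom_zero by simp
  show "\<ominus>\<^bsub>ZFact k\<^esub> ZMod k x = ZMod k (- x)"
    using hom_a_inv[of x] int_a_inv_eq by simp
qed

lemma carrier_ZFact: "carrier (ZFact k) = range (ZMod k)"
proof -
  have "carrier (R Quot I) = (+>\<^bsub>R\<^esub>) I ` carrier R" for R :: "int ring" and I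
    by (auto simp: FactRing_def A_RCOSETS_defs a_r_coset_def)
  from this[of \<Z> "Idl\<^bsub>\<Z>\<^esub> {k}"] show ?thesis
    by (simp add: ZFact_def ZMod_def[abs_def])
qed

text \<open>The inclusion of \<open>m + U\<close> in \<open>U\<close> is the backward implication
  for all \<open>x\<close>; the reverse inclusion, read at \<open>y - m\<close>, is the forward
  one.\<close>

lemma transl_stab_int_iff: "m \<in> transl_stab \<Z> U \<longleftrightarrow> (\<forall>x. x + m \<in> U \<longleftrightarrow> x \<in> U)"
proof -
  have "m <+\<^bsub>\<Z>\<^esub> U = (\<lambda>x. m + x) ` U"
    by (auto simp: a_l_coset_def')
  moreover have "(\<lambda>x. m + x) ` U = U \<longleftrightarrow> (\<forall>x. x + m \<in> U \<longleftrightarrow> x \<in> U)"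
  proof
    assume eq: "(\<lambda>x. m + x) ` U = U"
    show "\<forall>x. x + m \<in> U \<longleftrightarrow> x \<in> U"
      by (metis add.commute add_left_imp_eq eq image_iff)
  next
    assume shift: "\<forall>x. x + m \<in> U \<longleftrightarrow> x \<in> U"
    show "(\<lambda>x. m + x) ` U = U"
    proof
      show "U \<subseteq> (\<lambda>x. m + x) ` U"
      proof
        fix y
        assume "y \<in> U"
        then have "y - m \<in> U"
          using shift[rule_format, of "y - m"] by simp
        then show "y \<in> (\<lambda>x. m + x) ` U"
          by (auto intro: image_eqI[of _ _ "y - m"])
      qed
    qed (use shift in \<open>auto simp: add.commute\<close>)
  qed
  ultimately show ?thesis
    by (simp add: transl_stab_def)
qed

lemma int_ring_supportingI:
  assumes "ring_supporting \<Z> U" "transl_stab \<Z> U = range (\<lambda>k::int. int n * k)"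
  shows "int_ring_supporting U n"
proof
  show "0 \<in> U"
    using assms(1) by (simp add: ring_supporting_def)
  show "u + v \<in> U \<longleftrightarrow> v + w \<in> U" if "u \<in> U" "v \<in> U" "w \<in> U" "u + v + w \<in> U" for u v w
    using assms(1) that by (simp add: ring_supporting_def)
  show "(\<forall>x. x + m \<in> U \<longleftrightarrow> x \<in> U) \<longleftrightarrow> int n dvd m" for m
    using assms(2) transl_stab_int_iff[of m U] by (auto simp: dvd_def)
qed

section \<open>The image of \<open>U\<close> in Z/nZ\<close>

context int_ring_supporting
begin

text \<open>\<open>U\<close> is saturated for congruence modulo \<open>n\<close>, so any
  representative decides whether a class lies in the image. This pulls statements about classes back
  to \<open>U\<close>.\<close>

lemma ZMod_mem_image_iff: "ZMod (int n) x \<in> ZMod (int n) ` U \<longleftrightarrow> x \<in> U"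
  using cong_mem_iff by (auto simp: ZMod_eq_iff_dvd)

lemma ring_supporting_quotient: "ring_supporting (ZFact (int n)) (ZMod (int n) ` U)"
  unfolding ring_supporting_def
proof (intro conjI ballI impI)
  fix A B C
  let ?q = "ZMod (int n)" and ?add = "(\<oplus>\<^bsub>ZFact (int n)\<^esub>)"
  assume "A \<in> ?q ` U" "B \<in> ?q ` U" "C \<in> ?q ` U" and sum: "?add (?add A B) C \<in> ?q ` U"
  then obtain u v w where uvw: "u \<in> U" "v \<in> U" "w \<in> U" and ABC: "A = ?q u" "B = ?q v" "C = ?q w"
    by blast
  show "?add A B \<in> ?q ` U \<longleftrightarrow> ?add B C \<in> ?q ` U"
    using assoc_closed[OF uvw] sum unfolding ABC ZMod_add ZMod_mem_image_iff by blast
qed (auto simp: carrier_ZFact ZMod_zero ZMod_mem_image_iff zero_mem)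

text \<open>By saturation, a class stabilizes the image only if its representative \<open>m\<close>
  stabilizes \<open>U\<close>; then \<open>n\<close> divides \<open>m\<close> and the class is
  zero.\<close>

lemma transl_stab_quotient:
  "transl_stab (ZFact (int n)) (ZMod (int n) ` U) = {\<zero>\<^bsub>ZFact (int n)\<^esub>}"
proof -
  let ?q = "ZMod (int n)"
  have coset: "?q m <+\<^bsub>ZFact (int n)\<^esub> (?q ` U) = ?q ` (\<lambda>x. m + x) ` U" for m
    by (auto simp: a_l_coset_def' ZMod_add)
  have "?q ` (\<lambda>x. m + x) ` U = ?q ` U \<longleftrightarrow> int n dvd m" for m
  proof
    assume eq: "?q ` (\<lambda>x. m + x) ` U = ?q ` U"
    have "x + m \<in> U \<longleftrightarrow> x \<in> U" for x
    proof
      assume "x \<in> U"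
      then have "?q (m + x) \<in> ?q ` U"
        using eq by blast
      then show "x + m \<in> U"
        by (simp add: ZMod_mem_image_iff add.commute)
    next
      assume "x + m \<in> U"
      then have "?q (x + m) \<in> ?q ` (\<lambda>x. m + x) ` U"
        using eq by blast
      then obtain y where "y \<in> U" "int n dvd x + m - (m + y)"
        by (auto simp: ZMod_eq_iff_dvd)
      then show "x \<in> U"
        using cong_mem_iff[of x y] by simp
    qed
    then show "int n dvd m"
      using stab_iff by blast
  next
    assume "int n dvd m"
    then have "?q (m + x) = ?q x" for x
      by (simp add: ZMod_eq_iff_dvd)
    then show "?q ` (\<lambda>x. m + x) ` U = ?q ` U"
      by (simp add: image_image)
  qed
  then have "?q m \<in> transl_stab (ZFact (int n)) (?q ` U) \<longleftrightarrow> ?q m = ?q 0" for m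
    by (auto simp: transl_stab_def carrier_ZFact coset ZMod_eq_iff_dvd)
  moreover have "transl_stab (ZFact (int n)) (?q ` U) \<subseteq> range ?q"
    by (auto simp: transl_stab_def carrier_ZFact)
  ultimately show ?thesis
    unfolding ZMod_zero by auto
qed

text \<open>A common class is that of \<open>- u\<close> with \<open>u \<in> U\<close>. Saturation
  puts \<open>- u\<close> itself in \<open>U\<close>, hence \<open>n\<close> divides
  \<open>u\<close>.\<close>

lemma inter_uminus_quotient:
  "ZMod (int n) ` U \<inter> (a_set_inv\<^bsub>ZFact (int n)\<^esub> (ZMod (int n) ` U)) = {\<zero>\<^bsub>ZFact (int n)\<^esub>}"
proof -
  let ?q = "ZMod (int n)"
  have inv: "a_set_inv\<^bsub>ZFact (int n)\<^esub> (?q ` U) = ?q ` uminus ` U"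
    by (auto simp: A_SET_INV_def' ZMod_uminus)
  have "?q ` U \<inter> ?q ` uminus ` U = {?q 0}"
  proof
    show "?q ` U \<inter> ?q ` uminus ` U \<subseteq> {?q 0}"
    proof
      fix A
      assume A: "A \<in> ?q ` U \<inter> ?q ` uminus ` U"
      then obtain u where "u \<in> U" "A = ?q (- u)"
        by blast
      then show "A \<in> {?q 0}"
        using A uminus_mem_iff by (simp add: ZMod_mem_image_iff ZMod_eq_iff_dvd)
    qed
    show "{?q 0} \<subseteq> ?q ` U \<inter> ?q ` uminus ` U"
      using zero_mem by force
  qed
  then show ?thesis
    unfolding inv ZMod_zero .
qed

lemma eq_Union_quotient: "U = (\<Union>j\<in>ZMod (int n) ` U. j)"
  using cong_mem_iff by (auto simp: mem_ZMod_iff intro: bexI[of _ _ U])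

section \<open>The cases with and without an infinite interval\<close>

lemma infinite_interval_cases:
  assumes "contains_infinite_interval U"
  shows "exactly_one_of_three
           (U = UNIV \<and> n = 1)
           (U \<subseteq> {0..} \<and> submonoid U (add_monoid \<Z>))
           (U \<subseteq> {..0} \<and> submonoid U (add_monoid \<Z>))"
proof -
  have submonoid: "submonoid U (add_monoid \<Z>) \<longleftrightarrow> (\<forall>u\<in>U. \<forall>v\<in>U. u + v \<in> U)"
    using zero_mem by (auto simp: submonoid_def)
  interpret neg: int_ring_supporting "uminus ` U" n
    by (rule uminus_image)
  obtain a where "{a..} \<subseteq> U \<or> {..a} \<subseteq> U"
    using assms contains_infinite_interval_iff by blast
  then have ex: "(U = UNIV \<and> n = 1) \<or> (U \<subseteq> {0..} \<and> submonoid U (add_monoid \<Z>))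
    \<or> (U \<subseteq> {..0} \<and> submonoid U (add_monoid \<Z>))"
  proof
    assume "{a..} \<subseteq> U"
    then show ?thesis
      using ray_cases submonoid by blast
  next
    assume ray: "{..a} \<subseteq> U"
    have mem: "x \<in> uminus ` U \<longleftrightarrow> - x \<in> U" for x
      by (metis image_iff minus_minus)
    \<comment> \<open>The reflected set contains a right ray, so the right-ray dichotomy applies to
      it and is then reflected back.\<close>
    have "{- a..} \<subseteq> uminus ` U"
    proof
      fix x
      assume "x \<in> {- a..}"
      then have "- x \<in> {..a}"
        by auto
      then show "x \<in> uminus ` U"
        using ray mem by blast
    qed
    then consider "n = 1" "uminus ` U = UNIV"
      | "uminus ` U \<subseteq> {0..}" "\<forall>u\<in>uminus ` U. \<forall>v\<in>uminus ` U. u + v \<in> uminus ` U"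
      using neg.ray_cases by blast
    then show ?thesis
    proof cases
      case 1
      then have "U = UNIV"
        using mem by (metis UNIV_I UNIV_eq_I minus_minus)
      then show ?thesis
        using 1 by blast
    next
      case 2
      have "u + v \<in> U" if "u \<in> U" "v \<in> U" for u v
        using 2(2) mem[of "- u + - v"] that by (auto simp: add.commute)
      then show ?thesis
        using 2(1) submonoid by auto
    qed
  qed
  \<comment> \<open>The two monoid cases together would leave only \<open>0\<close>, contradicting
    infinitude.\<close>
  moreover have "\<not> (U \<subseteq> {0..} \<and> U \<subseteq> {..0})"
  proof
    assume "U \<subseteq> {0..} \<and> U \<subseteq> {..0}"
    then have "U \<subseteq> {0}"
      by force
    moreover obtain S where "infinite S" "S \<subseteq> U"
      using assms unfolding contains_infinite_interval_def by blast
    ultimately show False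
      by (meson finite.emptyI finite.insertI finite_subset)
  qed
  moreover have "\<not> (UNIV :: int set) \<subseteq> {0..}" "\<not> (UNIV :: int set) \<subseteq> {..0}"
    using subsetD[of UNIV "{0..}" "- 1 :: int"] subsetD[of UNIV "{..0}" "1 :: int"] by auto
  ultimately show ?thesis
    unfolding exactly_one_of_three_def by blast
qed

lemma finite_intervals:
  assumes "\<not> contains_infinite_interval U"
  shows "\<exists>(I :: int set) (a :: int \<Rightarrow> int) (b :: int \<Rightarrow> int).
            int_interval I \<and>
            U = (\<Union>i\<in>I. {a i..b i}) \<and>
            (\<forall>i\<in>I. a i \<le> b i \<and> (i + 1 \<in> I \<longrightarrow> b i < a (i + 1) - 1)) \<and>
            (\<exists>!i. i \<in> I \<and> 0 \<in> {a i..b i}) \<and>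
            (\<forall>i\<in>I. 0 \<in> {a i..b i} \<longrightarrow>
               (\<exists>r :: nat. ({a i..b i} = {0..int r} \<or> {a i..b i} = {- int r..0}) \<and>
                  (n > 1 \<longrightarrow> 2 * r < n)))"
proof -
  have no_rays: "\<nexists>c. {c..} \<subseteq> U" "\<nexists>c. {..c} \<subseteq> U"
    using assms contains_infinite_interval_iff by blast+
  obtain I :: "int set" and a b where I: "int_interval I" "U = (\<Union>i\<in>I. {a i..b i})"
    and le: "\<forall>i\<in>I. a i \<le> b i" and gap: "\<forall>i\<in>I. \<forall>j\<in>I. i < j \<longrightarrow> b i < a j - 1"
    by (rule int_set_maximal_intervals[OF no_rays])
  \<comment> \<open>Distinct intervals are separated by a gap, so they cannot share
    \<open>0\<close>.\<close>
  have "i = j" if "i \<in> I \<and> 0 \<in> {a i..b i}" "j \<in> I \<and> 0 \<in> {a j..b j}" for i j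
    using gap[rule_format, of i j] gap[rule_format, of j i] that
    by (cases i j rule: linorder_cases) auto
  then have "\<exists>!i. i \<in> I \<and> 0 \<in> {a i..b i}"
    using zero_mem I(2) by blast
  moreover have "U \<noteq> UNIV"
    using no_rays by blast
  then have "\<forall>i\<in>I. 0 \<in> {a i..b i} \<longrightarrow>
     (\<exists>r :: nat. ({a i..b i} = {0..int r} \<or> {a i..b i} = {- int r..0}) \<and> (n > 1 \<longrightarrow> 2 * r < n))"
    using zero_interval_shape I(2) by blast
  moreover have "\<forall>i\<in>I. a i \<le> b i \<and> (i + 1 \<in> I \<longrightarrow> b i < a (i + 1) - 1)"
    using le gap by simp
  ultimately show ?thesis
    using I by (intro exI[of _ I] exI[of _ a] exI[of _ b] conjI)
qed

end

theorem theorem4p2: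
  fixes U :: "int set" and n :: nat
  assumes "ring_supporting \<Z> U"
    and "transl_stab \<Z> U = range (\<lambda>k::int. int n * k)"
  shows "(\<exists>J. ring_supporting (ZFact (int n)) J \<and>
            transl_stab (ZFact (int n)) J = {\<zero>\<^bsub>ZFact (int n)\<^esub>} \<and>
            J \<inter> (a_set_inv\<^bsub>ZFact (int n)\<^esub> J) = {\<zero>\<^bsub>ZFact (int n)\<^esub>} \<and>
            U = (\<Union>j\<in>J. j))
    \<and> (contains_infinite_interval U \<longrightarrow>
         exactly_one_of_three
           (U = UNIV \<and> transl_stab \<Z> U = UNIV)
           (U \<subseteq> {0..} \<and> submonoid U (add_monoid \<Z>))
           (U \<subseteq> {..0} \<and> submonoid U (add_monoid \<Z>)))
    \<and> (\<not> contains_infinite_interval U \<longrightarrow>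
         (\<exists>(I :: int set) (a :: int \<Rightarrow> int) (b :: int \<Rightarrow> int).
            int_interval I \<and>
            U = (\<Union>i\<in>I. {a i..b i}) \<and>
            (\<forall>i\<in>I. a i \<le> b i \<and> (i + 1 \<in> I \<longrightarrow> b i < a (i + 1) - 1)) \<and>
            (\<exists>!i. i \<in> I \<and> 0 \<in> {a i..b i}) \<and>
            (\<forall>i\<in>I. 0 \<in> {a i..b i} \<longrightarrow>
               (\<exists>r :: nat. ({a i..b i} = {0..int r} \<or> {a i..b i} = {- int r..0}) \<and>
                  (n > 1 \<longrightarrow> 2 * r < n)))))"
proof -
  interpret int_ring_supporting U n
    using assms by (rule int_ring_supportingI)
  \<comment> \<open>When \<open>U\<close> is all of Z every translation stabilizes it, so
    \<open>n\<close> divides \<open>1\<close>; this turns the condition \<open>n = 1\<close> into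
    the stated one on the stabilizer.\<close>
  have "n = 1 \<longleftrightarrow> transl_stab \<Z> U = UNIV" if "U = UNIV"
    using that stab_iff[of 1] transl_stab_int_iff by auto
  then have iff: "U = UNIV \<and> n = 1 \<longleftrightarrow> U = UNIV \<and> transl_stab \<Z> U = UNIV"
    by blast
  show ?thesis
    by (intro conjI impI exI[of _ "ZMod (int n) ` U"] ring_supporting_quotient transl_stab_quotient
        inter_uminus_quotient eq_Union_quotient infinite_interval_cases[unfolded iff] finite_intervals)
qed

end
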